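(* Let $\phi=\frac{1+\sqrt5}{2}$. On every input sequence $I$ with agreeable deadlines, the deterministic online algorithm $\mathrm{MG}'$ (defined in the context) satisfies $\mathcal{G}_{\mathrm{MG}'}(I)\ge \frac{1}{\phi}\,\mathcal{G}_{\mathrm{OPT}}(I)$, where $\mathcal{G}_{\mathrm{OPT}}(I)$ is the maximum total weight of a feasible schedule of $I$; that is, $\mathrm{MG}'$ is $\phi$-competitive (with no additive constant) on sequences with agreeable deadlines.
   Context: Online packet scheduling (buffer management with bounded delay): time is divided into integer steps $1,2,\dots$. An input sequence is a finite set of packets; packet $j$ has a release time $r_j$ (a step), a deadline $d_j>r_j$ and a positive weight $w_j$. Packets released in the same step are assumed to arrive one after another (e.g. they have distinct fractional release times within the step), so release times are distinct. Packet $j$ is pending at step $t$ if $r_j\le t<d_j$ and $j$ has not yet been transmitted. In each step at most one pending packet may be transmitted; the gain is the total weight of transmitted packets. An online algorithm decides at step $t$ knowing only packets with $r_j\le t$. A sequence has agreeable deadlines if $r_i<r_j$ implies $d_i\le d_j$. A schedule is a map from steps to packets; it is feasible if it is injective and each packet assigned to step $t$ is pending at $t$. Define the linear order $\unlhd$ on packets: $i\unlhd j$ iff $d_i<d_j$, or $d_i=d_j$ and $w_i>w_j$, or $d_i=d_j$, $w_i=w_j$ and $r_i\le r_j$ (write $i\lhd j$ for $i\unlhd j$, $i\ne j$). A feasible schedule $S$ is a $\unlhd$-schedule if for every step $t$ the packet $S(t)$ is the $\unlhd$-minimum among the packets of $S$ pending at $t$. At step $t$, let $O_t$ be any (arbitrarily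 chosen) feasible $\unlhd$-schedule of maximum total weight over the packets currently pending in the algorithm's buffer at step $t$, using steps $\ge t$ and ignoring future arrivals. Let $e=O_t(t)$ be the $\unlhd$-minimal packet of $O_t$ and $h$ the $\unlhd$-minimal among the maximum-weight packets of $O_t$. Algorithm $\mathrm{MG}'$ at each step $t$: computes $O_t,e,h$; if $\phi w_e\ge w_h$ it transmits $e$, otherwise it transmits $h$. *)

theory Defs
  imports Complex_Main
begin

text \<open>Time steps are natural numbers \<open>1, 2, \<dots>\<close>. Packets released in the same step \<open>t\<close> arrive one
  after another; this is encoded by pairwise distinct real release times in \<open>(t - 1, t]\<close>, so that
  the step in which \<open>j\<close> is released is \<open>\<lceil>release j\<rceil>\<close>, and \<open>release j \<le> t\<close> iff \<open>j\<close> is released in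
  step \<open>t\<close> or earlier. Because release times are distinct, a packet is determined by its three
  attributes.\<close>

record packet =
  release :: real
  deadline :: nat
  weight :: real

definition input_sequence :: "packet set \<Rightarrow> bool" where
  "input_sequence I \<longleftrightarrow> finite I \<and> inj_on release I \<and>
     (\<forall>j\<in>I. 0 < release j \<and> \<lceil>release j\<rceil> < int (deadline j) \<and> 0 < weight j)"

text \<open>Only release \<^emph>\<open>steps\<close> are compared: packets released in the same step may have their deadlines
  in any order. In particular this is implied by the same condition on the exact release times.\<close>

definition agreeable :: "packet set \<Rightarrow> bool" where
  "agreeable I \<longleftrightarrow>
     (\<forall>i\<in>I. \<forall>j\<in>I. \<lceil>release i\<rceil> < \<lceil>release j\<rceil> \<longrightarrow> deadline i \<le> deadline j)"

lemma agreeable_if_exact_release: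
  assumes "\<forall>i\<in>I. \<forall>j\<in>I. release i < release j \<longrightarrow> deadline i \<le> deadline j"
  shows "agreeable I"
  using assms unfolding agreeable_def by (meson ceiling_mono not_le)

text \<open>A schedule is partial: \<open>None\<close> stands for an idle step.\<close>

type_synonym schedule = "nat \<Rightarrow> packet option"

definition pending :: "packet set \<Rightarrow> schedule \<Rightarrow> nat \<Rightarrow> packet set" where
  "pending X S t = {j \<in> X. release j \<le> real t \<and> t < deadline j \<and> (\<forall>s<t. S s \<noteq> Some j)}"

definition feasible :: "packet set \<Rightarrow> schedule \<Rightarrow> bool" where
  "feasible X S \<longleftrightarrow> inj_on S (dom S) \<and> (\<forall>t j. S t = Some j \<longrightarrow> j \<in> pending X S t)"

definition gain :: "schedule \<Rightarrow> real" where
  "gain S = (\<Sum>j\<in>ran S. weight j)"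

text \<open>For finite \<open>I\<close> the maximum ranges over a finite set of values, since \<open>ran S \<subseteq> I\<close>.\<close>

definition opt :: "packet set \<Rightarrow> real" where
  "opt I = Max {gain S | S. feasible I S}"

definition prec :: "packet \<Rightarrow> packet \<Rightarrow> bool" (infix "\<unlhd>" 50) where
  "i \<unlhd> j \<longleftrightarrow> deadline i < deadline j
     \<or> deadline i = deadline j \<and> weight i > weight j
     \<or> deadline i = deadline j \<and> weight i = weight j \<and> release i \<le> release j"

definition prec_min :: "packet set \<Rightarrow> packet \<Rightarrow> bool" where
  "prec_min X j \<longleftrightarrow> j \<in> X \<and> (\<forall>i\<in>X. j \<unlhd> i)"

text \<open>The condition on schedules using only steps from \<open>t0\<close> on. A step \<open>t\<close> may be idle only if no
  packet of \<open>S\<close> is pending at \<open>t\<close>.\<close>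

definition prec_schedule :: "nat \<Rightarrow> schedule \<Rightarrow> bool" where
  "prec_schedule t0 S \<longleftrightarrow> (\<forall>t\<ge>t0. case S t of
       None \<Rightarrow> pending (ran S) S t = {}
     | Some j \<Rightarrow> prec_min (pending (ran S) S t) j)"

definition plan :: "nat \<Rightarrow> packet set \<Rightarrow> schedule \<Rightarrow> bool" where
  "plan t B S \<longleftrightarrow> dom S \<subseteq> {t..} \<and> feasible B S \<and> prec_schedule t S"

definition optimal_plan :: "nat \<Rightarrow> packet set \<Rightarrow> schedule \<Rightarrow> bool" where
  "optimal_plan t B S \<longleftrightarrow> plan t B S \<and> (\<forall>S'. plan t B S' \<longrightarrow> gain S' \<le> gain S)"

definition heaviest :: "schedule \<Rightarrow> packet set" where
  "heaviest S = {j \<in> ran S. \<forall>i\<in>ran S. weight i \<le> weight j}"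

definition phi :: real ("\<phi>") where
  "\<phi> = (1 + sqrt 5) / 2"

text \<open>What is transmitted in step \<open>t\<close> when the computed optimal plan is \<open>S\<close>; nothing is transmitted
  if \<open>S\<close> is empty.\<close>

inductive mg_transmit :: "nat \<Rightarrow> schedule \<Rightarrow> packet option \<Rightarrow> bool" for t S where
  idle: "S = Map.empty \<Longrightarrow> mg_transmit t S None"
| transmit_e: "S t = Some e \<Longrightarrow> prec_min (heaviest S) h \<Longrightarrow> \<phi> * weight e \<ge> weight h
      \<Longrightarrow> mg_transmit t S (Some e)"
| transmit_h: "S t = Some e \<Longrightarrow> prec_min (heaviest S) h \<Longrightarrow> \<phi> * weight e < weight h
      \<Longrightarrow> mg_transmit t S (Some h)"

text \<open>\<open>mg_run I A\<close>: the schedule \<open>A\<close> is a possible output of the algorithm on \<open>I\<close>. The optimal plan of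
  each step is arbitrary, so different runs correspond to different rules for choosing it. The
  buffer \<open>pending I A t\<close> depends on \<open>A\<close> only through the steps before \<open>t\<close> and on \<open>I\<close> only through the
  packets released up to step \<open>t\<close>. Step \<open>0\<close> is idle as release times are positive.\<close>

definition mg_run :: "packet set \<Rightarrow> schedule \<Rightarrow> bool" where
  "mg_run I A \<longleftrightarrow>
     (\<forall>t. \<exists>S. optimal_plan t (pending I A t) S \<and> mg_transmit t S (A t))"

end

theory Submission
  imports Defs
begin

text \<open>Let \<open>V t\<close> be the maximum weight of a set of packets, not yet transmitted by the algorithm,
  that can be scheduled from step \<open>t\<close> on with full knowledge of future arrivals. It suffices to show
  \<open>V t \<le> \<phi> * w + V (t + 1)\<close>, where \<open>w\<close> is the gain of the algorithm in step \<open>t\<close>. By matroid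
  exchange, an optimal set \<open>Y\<close> for \<open>V t\<close> can be chosen among the packets of the plan computed in
  step \<open>t\<close> and the future ones. Removing from \<open>Y\<close> the packet scheduled at \<open>t\<close> loses at most \<open>w_h\<close>,
  and if \<open>e\<close> is in \<open>Y\<close> it may be assumed to be that packet.

  If \<open>e\<close> is transmitted, then \<open>w_h \<le> \<phi> * w_e\<close>, so removing \<open>e\<close>, or the packet scheduled at \<open>t\<close> if
  \<open>e\<close> is not in \<open>Y\<close>, is affordable. If \<open>h\<close> is transmitted and both \<open>e\<close> and \<open>h\<close> are in \<open>Y\<close>, remove
  both: \<open>w_e + w_h < (1 / \<phi> + 1) * w_h = \<phi> * w_h\<close>. The remaining case, \<open>h\<close> in \<open>Y\<close> but not \<open>e\<close>,
  is where agreeable deadlines matter: the packets of \<open>Y\<close> due before \<open>h\<close> have all arrived and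
  belong to the plan, which has room for \<open>e\<close> as well, so they can be postponed by one step at the
  expense of \<open>h\<close> alone.\<close>

section \<open>Sets of packets that can be scheduled\<close>

definition fits :: "nat \<Rightarrow> packet \<Rightarrow> nat \<Rightarrow> bool" where
  "fits t j s \<longleftrightarrow> t \<le> s \<and> release j \<le> real s \<and> s < deadline j"

definition placement :: "nat \<Rightarrow> packet set \<Rightarrow> (packet \<Rightarrow> nat) \<Rightarrow> bool" where
  "placement t Y f \<longleftrightarrow> inj_on f Y \<and> (\<forall>j\<in>Y. fits t j (f j))"

text \<open>These are the independent sets of the transversal matroid given by packets and the slots
  they fit, with slots from \<open>t\<close> on only.\<close>

definition schedulable :: "nat \<Rightarrow> packet set \<Rightarrow> bool" where
  "schedulable t Y \<longleftrightarrow> (\<exists>f. placement t Y f)"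

lemma disjoint_imageI: "(\<And>z. z \<in> D \<Longrightarrow> g z \<notin> A) \<Longrightarrow> A \<inter> g ` D = {}"
  by blast

lemma placement_subset: "placement t Y f \<Longrightarrow> Z \<subseteq> Y \<Longrightarrow> placement t Z f"
  by (auto simp: placement_def intro: inj_on_subset)

lemma schedulable_subset: "schedulable t Y \<Longrightarrow> Z \<subseteq> Y \<Longrightarrow> schedulable t Z"
  by (auto simp: schedulable_def intro: placement_subset)

lemma placement_eqD: "placement t Y f \<Longrightarrow> i \<in> Y \<Longrightarrow> j \<in> Y \<Longrightarrow> f i = f j \<Longrightarrow> i = j"
  by (auto simp: placement_def dest: inj_onD)

lemma placement_fits: "placement t Y f \<Longrightarrow> j \<in> Y \<Longrightarrow> fits t j (f j)"
  by (auto simp: placement_def)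

lemma schedulable_Un:
  assumes "placement t C f" "placement t D g" "f ` C \<inter> g ` D = {}"
  shows "schedulable t (C \<union> D)"
proof -
  let ?h = "\<lambda>z. if z \<in> C then f z else g z"
  have "inj_on ?h (C \<union> D)"
  proof (rule inj_onI)
    fix a b assume ab: "a \<in> C \<union> D" "b \<in> C \<union> D" "?h a = ?h b"
    have "f c \<noteq> g d" if "c \<in> C" "d \<in> D" for c d
      using assms(3) that by auto
    then show "a = b"
      using ab placement_eqD[OF assms(1), of a b] placement_eqD[OF assms(2), of a b]
      by (cases "a \<in> C"; cases "b \<in> C") (auto dest: sym)
  qed
  then have "placement t (C \<union> D) ?h"
    using assms(1,2) by (auto simp: placement_def)
  then show ?thesis by (auto simp: schedulable_def)
qed

lemma placement_Suc:
  assumes "placement t Y f" "\<forall>j\<in>Y. f j \<noteq> t"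
  shows "placement (Suc t) Y f"
  using assms by (fastforce simp: placement_def fits_def)

lemma placement_upd:
  assumes "placement t (Y - {j}) f" "fits t j s" "s \<notin> f ` (Y - {j})"
  shows "placement t Y (f(j := s))"
proof -
  have "inj_on (f(j := s)) (Y - {j})"
    using assms(1) by (simp add: placement_def inj_on_def)
  moreover have "(f(j := s)) j \<notin> (f(j := s)) ` (Y - {j})" using assms(3) by auto
  ultimately have "inj_on (f(j := s)) (insert j (Y - {j}))"
    by (simp only: inj_on_insert) auto
  then have "inj_on (f(j := s)) Y" by (rule inj_on_subset) auto
  then show ?thesis using assms(1,2) by (simp add: placement_def)
qed

section \<open>Alternating paths and matroid exchange\<close>

text \<open>\<open>C\<close> consists of the points on the path that starts at \<open>x\<close> and moves from \<open>y\<close> to the element of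
  \<open>Z\<close> that \<open>g\<close> maps to \<open>f y\<close>, until it leaves \<open>Y\<close>; \<open>s\<close> is the value of \<open>f\<close> at its end point.\<close>

lemma alternating_path:
  fixes f g :: "'a \<Rightarrow> 'b"
  assumes "finite Y" "inj_on f Y" "inj_on g Z" "x \<in> Y" "x \<notin> Z"
  obtains C s where "C \<subseteq> Y" "x \<in> C" "C - {x} \<subseteq> Z" "f ` C = insert s (g ` (C - {x}))"
    "s \<notin> g ` (C - {x})" "\<And>z. z \<in> Z \<inter> Y \<Longrightarrow> g z \<noteq> s"
proof -
  define R where "R = {(y, z). z \<in> Z \<inter> Y \<and> g z = f y}"
  define C where "C = R\<^sup>* `` {x}"
  have xC: "x \<in> C" by (simp add: C_def)
  have sub: "c = x \<or> c \<in> Z \<inter> Y \<and> g c \<in> f ` C" if "c \<in> C" for c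
  proof -
    have "(x, c) \<in> R\<^sup>*" using that by (simp add: C_def)
    then show ?thesis
      by (cases rule: rtranclE) (auto simp: C_def R_def)
  qed
  \<comment> \<open>Closure under successors keeps elements of \<open>Z \<inter> Y\<close> off
    \<open>s\<close>: one mapped to \<open>s\<close> would lie on the path, where \<open>s\<close>
    is not attained.\<close>
  have closed: "z \<in> C" if z: "z \<in> Z \<inter> Y" "g z \<in> f ` C" for z
  proof -
    obtain y where y: "y \<in> C" "g z = f y" using z by blast
    then have "(y, z) \<in> R" using z by (auto simp: R_def)
    then show ?thesis using y by (auto simp: C_def intro: rtrancl_into_rtrancl)
  qed
  have CY: "C \<subseteq> Y" using sub assms(4) by auto
  have CZ: "C - {x} \<subseteq> Z" using sub by auto
  have fin: "finite C" using CY assms(1) finite_subset by blast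
  have im: "g ` (C - {x}) \<subseteq> f ` C" using sub by auto
  \<comment> \<open>Counting shows that \<open>f\<close> takes exactly one value on \<open>C\<close>
    that \<open>g\<close> does not take on \<open>C - {x}\<close>; it becomes
    \<open>s\<close>.\<close>
  have "card (g ` (C - {x})) = card C - 1"
    using card_image[OF inj_on_subset[OF assms(3) CZ]] xC fin by simp
  moreover have "card (f ` C) = card C"
    using card_image[OF inj_on_subset[OF assms(2) CY]] .
  moreover have "card C > 0" using xC fin card_gt_0_iff by blast
  ultimately have "card (f ` C - g ` (C - {x})) = 1"
    using im fin by (subst card_Diff_subset) auto
  then obtain s where s: "f ` C - g ` (C - {x}) = {s}"
    by (auto simp: card_1_singleton_iff)
  show ?thesis
  proof (rule that[OF CY xC CZ])
    show "f ` C = insert s (g ` (C - {x}))" using s im by auto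
    show "s \<notin> g ` (C - {x})" using s by auto
    fix z assume z: "z \<in> Z \<inter> Y"
    show "g z \<noteq> s"
    proof
      assume "g z = s"
      moreover have "s \<in> f ` C" using s by blast
      ultimately have "z \<in> C" using closed[OF z] by simp
      moreover have "z \<noteq> x" using z assms(5) by auto
      ultimately show False using \<open>g z = s\<close> s by auto
    qed
  qed
qed

lemma schedulable_exchange:
  assumes "finite Y" "schedulable t Y" "schedulable t Z" "x \<in> Y" "x \<notin> Z"
    and max: "\<not> schedulable t (insert x Z)"
  obtains y where "y \<in> Z" "y \<notin> Y" "schedulable t (insert x (Z - {y}))"
    "schedulable t (insert y (Y - {x}))"
proof -
  obtain f g where f: "placement t Y f" and g: "placement t Z g"
    using assms by (auto simp: schedulable_def)
  obtain C s where C: "C \<subseteq> Y" "x \<in> C" "C - {x} \<subseteq> Z"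
    and im: "f ` C = insert s (g ` (C - {x}))"
    and s: "s \<notin> g ` (C - {x})" "\<And>z. z \<in> Z \<inter> Y \<Longrightarrow> g z \<noteq> s"
    using alternating_path[of Y f g Z x] f g assms by (auto simp: placement_def)
  have disj: "g z \<noteq> s \<Longrightarrow> g z \<notin> f ` C" if "z \<in> Z - C" for z
  proof
    assume "g z \<noteq> s" "g z \<in> f ` C"
    then obtain c where "c \<in> C - {x}" "g z = g c" using im by auto
    then show False using that C placement_eqD[OF g, of z c] by auto
  qed
  have "\<exists>y\<in>Z. g y = s"
  proof (rule ccontr)
    assume "\<not> ?thesis"
    then have "f ` C \<inter> g ` (Z - C) = {}"
      using disj by (intro disjoint_imageI) blast
    then have "schedulable t (C \<union> (Z - C))"
      using placement_subset[OF f] placement_subset[OF g] C by (intro schedulable_Un) auto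
    moreover have "C \<union> (Z - C) = insert x Z" using C by auto
    ultimately show False using max by simp
  qed
  then obtain y where y: "y \<in> Z" "g y = s" by blast
  have yY: "y \<notin> Y" using s y by auto
  then have yC: "y \<notin> C" using C by auto
  have "f ` C \<inter> g ` (Z - C - {y}) = {}"
    using disj y placement_eqD[OF g, of _ y] by (intro disjoint_imageI) blast
  moreover have "placement t (Z - C - {y}) g" by (rule placement_subset[OF g]) auto
  ultimately have "schedulable t (C \<union> (Z - C - {y}))"
    using placement_subset[OF f C(1)] schedulable_Un by blast
  moreover have "C \<union> (Z - C - {y}) = insert x (Z - {y})" using C yC by auto
  moreover have "schedulable t (insert y (C - {x}) \<union> (Y - C))"
  proof (rule schedulable_Un)
    show "placement t (insert y (C - {x})) g" using placement_subset[OF g] C y by auto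
    show "placement t (Y - C) f" using placement_subset[OF f] by auto
    have "g ` insert y (C - {x}) = f ` C" using im y by auto
    then show "g ` insert y (C - {x}) \<inter> f ` (Y - C) = {}"
      using placement_eqD[OF f] C by (auto dest: subsetD)
  qed
  moreover have "insert y (C - {x}) \<union> (Y - C) = insert y (Y - {x})" using C by auto
  ultimately show ?thesis using that y yY by simp
qed

section \<open>Passing from step \<open>t\<close> to step \<open>Suc t\<close>\<close>

text \<open>A packet other than \<open>e\<close> in slot \<open>t\<close> can move to the slot of
  \<open>e\<close>: it is already released and due no earlier than \<open>e\<close>.\<close>

lemma schedulable_Suc_remove_earliest:
  assumes "schedulable t Y" "e \<in> Y" "\<And>j. j \<in> Y \<Longrightarrow> release j \<le> real t \<Longrightarrow> deadline e \<le> deadline j"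
  shows "schedulable (Suc t) (Y - {e})"
proof -
  obtain f where f: "placement t Y f" using assms by (auto simp: schedulable_def)
  note fe = placement_fits[OF f \<open>e \<in> Y\<close>]
  have fY: "placement t (Y - {e}) f" by (rule placement_subset[OF f]) auto
  show ?thesis
  proof (cases "\<exists>j\<in>Y - {e}. f j = t")
    case False
    then show ?thesis using placement_Suc[OF fY] by (auto simp: schedulable_def)
  next
    case True
    then obtain j where j: "j \<in> Y" "j \<noteq> e" "f j = t" by auto
    then have rel: "release j \<le> real t" using placement_fits[OF f, of j] by (auto simp: fits_def)
    have ne: "f e \<noteq> t" using j placement_eqD[OF f, of j e] assms(2) by auto
    have "placement (Suc t) (Y - {e} - {j}) f"
      using placement_eqD[OF f] j by (intro placement_Suc placement_subset[OF f]) auto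
    moreover have "fits (Suc t) j (f e)"
      using fe ne rel assms(3)[OF j(1) rel] by (auto simp: fits_def)
    moreover have "f e \<notin> f ` (Y - {e} - {j})"
      using placement_eqD[OF f] assms(2) by auto
    ultimately show ?thesis unfolding schedulable_def by (blast intro: placement_upd)
  qed
qed

lemma schedulable_Suc_remove_one:
  assumes "schedulable t Y"
  obtains "schedulable (Suc t) Y"
    | j where "j \<in> Y" "release j \<le> real t" "schedulable (Suc t) (Y - {j})"
proof -
  obtain f where f: "placement t Y f" using assms by (auto simp: schedulable_def)
  show ?thesis
  proof (cases "\<exists>j\<in>Y. f j = t")
    case False
    then show ?thesis using placement_Suc[OF f] that(1) by (auto simp: schedulable_def)
  next
    case True
    then obtain j where j: "j \<in> Y" "f j = t" by auto
    have "placement (Suc t) (Y - {j}) f"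
      using placement_eqD[OF f] j by (intro placement_Suc placement_subset[OF f]) auto
    then show ?thesis
      using j that(2)[of j] placement_fits[OF f, of j] by (auto simp: schedulable_def fits_def)
  qed
qed

text \<open>Dropping \<open>h\<close> frees \<open>f h\<close>, which the packet \<open>x\<close> in
  slot \<open>t\<close> can use unless it is due before \<open>h\<close>. In that case
  \<open>x\<close> is placed by \<open>p\<close>, and the displacements are followed along an
  alternating path inside \<open>P\<close>; at most one conflict remains, at slot \<open>s\<close>,
  and \<open>f h\<close> resolves it.\<close>

lemma schedulable_Suc_remove_above:
  assumes "finite Y" "schedulable t Y" "h \<in> Y"
    and P: "P = {j \<in> Y. deadline j < deadline h}"
    and "schedulable (Suc t) P" and rel: "\<And>j. j \<in> P \<Longrightarrow> release j \<le> real t"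
  shows "schedulable (Suc t) (Y - {h})"
proof -
  obtain f p where f: "placement t Y f" and p: "placement (Suc t) P p"
    using assms by (auto simp: schedulable_def)
  note fh = placement_fits[OF f \<open>h \<in> Y\<close>]
  show ?thesis
  proof (cases "\<exists>j\<in>Y - {h}. f j = t")
    case False
    then have "placement (Suc t) (Y - {h}) f"
      by (intro placement_Suc placement_subset[OF f]) auto
    then show ?thesis by (auto simp: schedulable_def)
  next
    case True
    then obtain x where x: "x \<in> Y" "x \<noteq> h" "f x = t" by auto
    have pS: "placement (Suc t) (Y - {x}) f"
      using placement_eqD[OF f] x by (intro placement_Suc placement_subset[OF f]) auto
    have ht: "t < f h" using x placement_eqD[OF f, of x h] assms(3) fh
      by (cases "f h = t") (auto simp: fits_def)
    show ?thesis
    proof (cases "x \<in> P")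
      case False
      then have "fits (Suc t) x (f h)"
        using x P ht fh placement_fits[OF f, of x] by (auto simp: fits_def)
      moreover have "placement (Suc t) (Y - {h} - {x}) f"
        by (rule placement_subset[OF pS]) auto
      moreover have "f h \<notin> f ` (Y - {h} - {x})"
        using placement_eqD[OF f] assms(3) by auto
      ultimately show ?thesis unfolding schedulable_def by (blast intro: placement_upd)
    next
      case True
      have "finite P" using P assms(1) by auto
      then obtain C s where C: "C \<subseteq> P" "x \<in> C" "C - {x} \<subseteq> Y - {x}"
        and im: "p ` C = insert s (f ` (C - {x}))"
        and s: "s \<notin> f ` (C - {x})" "\<And>z. z \<in> (Y - {x}) \<inter> P \<Longrightarrow> f z \<noteq> s"
        using alternating_path[of P p f "Y - {x}" x] p pS True
        by (auto simp: placement_def)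
      have hC: "h \<notin> C" using C P by auto
      have split: "C \<union> (Y - C - {h}) = Y - {h}" using C P hC by auto
      have pC: "placement (Suc t) C p" using placement_subset[OF p] C by auto
      have fC: "placement (Suc t) (Y - C - {h}) f"
        using C by (intro placement_subset[OF pS]) auto
      have disj: "f z \<notin> f ` (C - {x})" if "z \<in> Y - C" for z
        using placement_eqD[OF f, of z] that C by auto
      show ?thesis
      proof (cases "\<exists>z\<in>Y - {x, h}. f z = s")
        case False
        \<comment> \<open>Here \<open>s\<close> may be \<open>f h\<close> itself, which is free
          because \<open>h\<close> is dropped.\<close>
        then have "f z \<notin> p ` C" if "z \<in> Y - C - {h}" for z
          using that im disj[of z] C by (auto simp del: image_insert)
        then have "p ` C \<inter> f ` (Y - C - {h}) = {}" by (rule disjoint_imageI)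
        then show ?thesis using schedulable_Un[OF pC fC] split by simp
      next
        case True
        then obtain z where z: "z \<in> Y" "z \<noteq> x" "z \<noteq> h" "f z = s" by auto
        \<comment> \<open>The path does not end at a slot of a packet of \<open>P - {x}\<close>, so
          \<open>z\<close> is due no earlier than \<open>h\<close>.\<close>
        have zP: "z \<notin> P" using s z by auto
        have sh: "s \<noteq> f h" using z placement_eqD[OF f, of z h] assms(3) by auto
        obtain y where y: "y \<in> C" "p y = s" using im by (metis imageE insertI1)
        have yfit: "fits (Suc t) y s" using placement_fits[OF pC y(1)] y by simp
        show ?thesis
        proof (cases "s < f h")
          case True
          \<comment> \<open>\<open>z\<close> is due no earlier than \<open>h\<close> and can take over its later slot.\<close>
          have "placement (Suc t) (Y - C - {h}) (f(z := f h))"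
          proof (rule placement_upd)
            show "placement (Suc t) (Y - C - {h} - {z}) f"
              by (rule placement_subset[OF fC]) auto
            show "fits (Suc t) z (f h)"
              using True ht fh zP z P placement_fits[OF f, of z] by (auto simp: fits_def)
            show "f h \<notin> f ` (Y - C - {h} - {z})"
              using placement_eqD[OF f] assms(3) by auto
          qed
          moreover have "p ` C \<inter> (f(z := f h)) ` (Y - C - {h}) = {}"
          proof -
            have "(f(z := f h)) w \<notin> p ` C" if "w \<in> Y - C - {h}" for w
              using that im disj[of w] disj[of h] hC assms(3) sh z(1,4)
                placement_eqD[OF f, of w z] by (auto simp del: image_insert)
            then show ?thesis by (rule disjoint_imageI)
          qed
          ultimately show ?thesis using schedulable_Un[OF pC] split by metis
        next
          case False
          \<comment> \<open>\<open>y\<close> is available from step \<open>t\<close> on and can use the earlier slot of \<open>h\<close> instead of \<open>s\<close>.\<close>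
          have other: "p ` (C - {y}) \<subseteq> f ` (C - {x})"
          proof
            fix v assume "v \<in> p ` (C - {y})"
            then obtain c where c: "c \<in> C" "c \<noteq> y" "v = p c" by auto
            then have "v \<noteq> s" using placement_eqD[OF pC, of c y] y by auto
            then show "v \<in> f ` (C - {x})" using c im by blast
          qed
          have "placement (Suc t) C (p(y := f h))"
          proof (rule placement_upd)
            show "placement (Suc t) (C - {y}) p" by (rule placement_subset[OF pC]) auto
            show "fits (Suc t) y (f h)"
              using False ht yfit rel[of y] y C by (fastforce simp: fits_def)
            show "f h \<notin> p ` (C - {y})" using other disj[of h] hC assms(3) by auto
          qed
          moreover have "(p(y := f h)) ` C \<inter> f ` (Y - C - {h}) = {}"
          proof -
            have "(p(y := f h)) ` C \<subseteq> insert (f h) (f ` (C - {x}))"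
              using other by auto
            moreover have "f w \<notin> insert (f h) (f ` (C - {x}))" if "w \<in> Y - C - {h}" for w
              using disj[of w] that placement_eqD[OF f, of w h] assms(3) by auto
            ultimately show ?thesis by (intro disjoint_imageI) blast
          qed
          ultimately show ?thesis using schedulable_Un[OF _ fC] split by metis
        qed
      qed
    qed
  qed
qed

section \<open>Exchanging into an optimal buffer set\<close>

text \<open>\<open>B\<close> is the buffer and \<open>F\<close> the set of future packets, which exchanges leave untouched.\<close>

lemma schedulable_reduce_to_optimal:
  assumes "finite Y" "schedulable t Y" "Y \<subseteq> B \<union> F" "finite Z" "Z \<subseteq> B" "schedulable t Z"
    and pos: "\<And>j. j \<in> B \<Longrightarrow> 0 < weight j"
    and opt: "\<And>Z'. Z' \<subseteq> B \<Longrightarrow> schedulable t Z' \<Longrightarrow> finite Z' \<Longrightarrow> sum weight Z' \<le> sum weight Z"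
  obtains Y' where "Y' \<subseteq> Z \<union> F" "finite Y'" "schedulable t Y'" "sum weight Y \<le> sum weight Y'"
  using assms(1-3)
proof (induction "card (Y \<inter> B - Z)" arbitrary: Y thesis rule: less_induct)
  case less
  show ?case
  proof (cases "Y \<inter> B - Z = {}")
    case True
    then show ?thesis using less.prems by blast
  next
    case False
    then obtain x where x: "x \<in> Y" "x \<in> B" "x \<notin> Z" by auto
    have "\<not> schedulable t (insert x Z)"
    proof
      assume "schedulable t (insert x Z)"
      then have "sum weight (insert x Z) \<le> sum weight Z"
        using x assms by (intro opt) auto
      then show False using x pos[of x] assms(4) by simp
    qed
    then obtain y where y: "y \<in> Z" "y \<notin> Y" "schedulable t (insert x (Z - {y}))"
      "schedulable t (insert y (Y - {x}))"
      using schedulable_exchange[OF less.prems(2,3) assms(6) x(1,3)] by blast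
    \<comment> \<open>The first exchanged set competes with the optimal \<open>Z\<close>, which
      gives the weight comparison; the second one replaces \<open>Y\<close> and is closer to
      \<open>Z\<close>.\<close>
    have "sum weight (insert x (Z - {y})) \<le> sum weight Z"
      using x y assms by (intro opt) auto
    then have w: "weight x \<le> weight y"
      using x y assms(4) by (simp add: sum_diff1)
    let ?Y = "insert y (Y - {x})"
    have eq: "?Y \<inter> B - Z = Y \<inter> B - Z - {x}" using y(1) by blast
    have "card (?Y \<inter> B - Z) < card (Y \<inter> B - Z)"
      unfolding eq using less.prems(2) x by (intro card_Diff1_less) auto
    moreover have le: "sum weight Y \<le> sum weight ?Y"
      using w x y less.prems(2) by (simp add: sum_diff1)
    moreover have "finite ?Y" "?Y \<subseteq> B \<union> F" using less.prems y assms(5) by auto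
    ultimately obtain Y' where "Y' \<subseteq> Z \<union> F" "finite Y'" "schedulable t Y'" "sum weight ?Y \<le> sum weight Y'"
      using less.hyps[of ?Y] y(4) by blast
    then show ?thesis using less.prems(1) le by (meson order_trans)
  qed
qed

section \<open>Plans\<close>

lemma prec_refl: "i \<unlhd> i"
  by (simp add: prec_def)

lemma prec_linear: "i \<unlhd> j \<or> j \<unlhd> i"
  by (auto simp: prec_def)

lemma prec_trans: "i \<unlhd> j \<Longrightarrow> j \<unlhd> k \<Longrightarrow> i \<unlhd> k"
  by (auto simp: prec_def)

lemma prec_deadline: "i \<unlhd> j \<Longrightarrow> deadline i \<le> deadline j"
  by (auto simp: prec_def)

lemma ex_prec_min:
  assumes "finite Y" "Y \<noteq> {}"
  obtains e where "prec_min Y e"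
proof -
  have "\<exists>e. prec_min Y e"
    using assms
  proof (induction Y rule: finite_ne_induct)
    case (singleton x)
    then show ?case by (auto simp: prec_min_def prec_refl)
  next
    case (insert x Y)
    then obtain e where e: "e \<in> Y" "\<And>i. i \<in> Y \<Longrightarrow> e \<unlhd> i" by (auto simp: prec_min_def)
    show ?case
    proof (cases "x \<unlhd> e")
      case True
      then have "prec_min (insert x Y) x"
        using e prec_refl prec_trans by (auto simp: prec_min_def)
      then show ?thesis by blast
    next
      case False
      then have "prec_min (insert x Y) e"
        using e prec_linear by (auto simp: prec_min_def)
      then show ?thesis by blast
    qed
  qed
  then show ?thesis using that by blast
qed

text \<open>Greedy construction: the \<open>prec_min\<close> packet goes to slot \<open>t\<close>,
  and having the earliest deadline it leaves a set schedulable from \<open>Suc t\<close>.\<close>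

lemma ex_plan:
  assumes "finite Y" "schedulable t Y" "\<And>j. j \<in> Y \<Longrightarrow> release j \<le> real t"
  obtains S where "plan t Y S" "ran S = Y"
  using assms
proof (induction "card Y" arbitrary: Y t thesis)
  case 0
  then have "Y = {}" by simp
  then show ?case
    using 0(2)[of Map.empty] by (auto simp: plan_def feasible_def prec_schedule_def pending_def)
next
  case (Suc n)
  then have "Y \<noteq> {}" by auto
  then obtain e where e: "prec_min Y e" using ex_prec_min Suc by blast
  then have eY: "e \<in> Y" by (simp add: prec_min_def)
  have "schedulable (Suc t) (Y - {e})"
    using e prec_deadline Suc by (intro schedulable_Suc_remove_earliest) (auto simp: prec_min_def)
  moreover have "release j \<le> real (Suc t)" if "j \<in> Y - {e}" for j
    using Suc.prems(4)[of j] that by simp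
  moreover have "n = card (Y - {e})" using Suc.hyps(2) eY by simp
  moreover have "finite (Y - {e})" using Suc.prems(2) by simp
  ultimately obtain S where S: "plan (Suc t) (Y - {e}) S" "ran S = Y - {e}"
    using Suc.hyps(1)[of "Y - {e}" "Suc t"] by blast
  have dS: "dom S \<subseteq> {Suc t..}" using S by (simp add: plan_def)
  have None: "S s = None" if "s \<le> t" for s using dS that by (force simp: subset_iff dom_def)
  let ?S = "S(t \<mapsto> e)"
  have ran: "ran ?S = Y" using S None[of t] eY by auto
  have dl: "t < deadline j" if "j \<in> Y" for j
    using Suc.prems(3) that by (fastforce simp: schedulable_def placement_def fits_def)
  have pend_t: "pending Y ?S t = Y"
    using Suc.prems(4) dl None by (auto simp: pending_def)
  \<comment> \<open>Transmitting \<open>e\<close> at \<open>t\<close> has the same effect on later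
    steps as deleting it, so the conditions on \<open>S\<close> carry over.\<close>
  have pend_later: "pending Y ?S s = pending (Y - {e}) S s" if "t < s" for s
    using that None by (auto simp: pending_def)
  have neS: "S s \<noteq> Some e" for s using S(2) by (metis Diff_iff insertI1 ranI)
  have "feasible Y ?S"
    unfolding feasible_def
  proof
    have "inj_on S (dom S)" using S by (simp add: plan_def feasible_def)
    then have "inj_on ?S (dom S)"
      using None[of t] by (auto simp: inj_on_def dom_def)
    then show "inj_on ?S (dom ?S)"
      using neS None[of t] by (auto simp: image_iff)
    show "\<forall>s j. ?S s = Some j \<longrightarrow> j \<in> pending Y ?S s"
    proof (intro allI impI)
      fix s j assume sj: "?S s = Some j"
      show "j \<in> pending Y ?S s"
      proof (cases "s = t")
        case True
        then show ?thesis using sj pend_t eY by simp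
      next
        case False
        then have "S s = Some j" using sj by simp
        moreover from this have "t < s" using None[of s] by (cases "s \<le> t") auto
        ultimately show ?thesis using pend_later S by (auto simp: plan_def feasible_def)
      qed
    qed
  qed
  moreover have "prec_schedule t ?S"
    unfolding prec_schedule_def
  proof (intro allI impI)
    fix s assume "t \<le> s"
    then consider "s = t" | "t < s" by linarith
    then show "case ?S s of None \<Rightarrow> pending (ran ?S) ?S s = {}
      | Some j \<Rightarrow> prec_min (pending (ran ?S) ?S s) j"
    proof cases
      case 1
      then show ?thesis unfolding ran using pend_t e by simp
    next
      case 2
      then have "case S s of None \<Rightarrow> pending (ran S) S s = {}
        | Some j \<Rightarrow> prec_min (pending (ran S) S s) j"
        using S by (auto simp: plan_def prec_schedule_def)
      then show ?thesis using 2 unfolding ran pend_later[OF 2] S(2) by simp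
    qed
  qed
  moreover have "dom ?S \<subseteq> {t..}" using dS by auto
  ultimately have "plan t Y ?S" by (simp add: plan_def)
  then show ?case using ran Suc.prems(1) by blast
qed

lemma plan_mono: "plan t X S \<Longrightarrow> X \<subseteq> X' \<Longrightarrow> plan t X' S"
  by (auto simp: plan_def feasible_def pending_def)

lemma feasible_ran: "feasible X S \<Longrightarrow> ran S \<subseteq> X"
  by (auto simp: feasible_def pending_def ran_def)

lemma feasible_schedulable:
  assumes "feasible X S" "dom S \<subseteq> {t..}"
  shows "schedulable t (ran S)"
proof -
  define f where "f j = (SOME s. S s = Some j)" for j
  have f: "S (f j) = Some j" if "j \<in> ran S" for j
    using that unfolding f_def ran_def by (auto intro: someI)
  have "inj_on f (ran S)" by (rule inj_onI) (metis f option.inject)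
  moreover have "fits t j (f j)" if "j \<in> ran S" for j
    using f[OF that] assms by (auto simp: feasible_def pending_def fits_def)
  ultimately show ?thesis by (auto simp: schedulable_def placement_def)
qed

text \<open>\<open>optimal_plan\<close> compares only with plans, but \<open>ex_plan\<close> turns
  every schedulable subset of the buffer into a plan of the same weight.\<close>

lemma optimal_plan_max:
  assumes "optimal_plan t B S" "\<And>j. j \<in> B \<Longrightarrow> release j \<le> real t"
    and "Z \<subseteq> B" "schedulable t Z" "finite Z"
  shows "sum weight Z \<le> sum weight (ran S)"
proof -
  obtain S' where "plan t Z S'" "ran S' = Z"
    using ex_plan[of Z t] assms(2-5) by blast
  then have "gain S' \<le> gain S" "ran S' = Z"
    using assms(1,3) plan_mono by (auto simp: optimal_plan_def)
  then show ?thesis by (simp add: gain_def)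
qed

lemma plan_head_prec_min:
  assumes "plan t B S" "\<And>j. j \<in> B \<Longrightarrow> release j \<le> real t \<and> t < deadline j" "S t = Some e"
  shows "prec_min (ran S) e"
proof -
  have "S s = None" if "s < t" for s
    using assms(1) that by (force simp: plan_def subset_iff dom_def)
  moreover have "ran S \<subseteq> B" using assms(1) by (simp add: plan_def feasible_ran)
  ultimately have "pending (ran S) S t = ran S"
    using assms(2) by (auto simp: pending_def)
  moreover have "prec_min (pending (ran S) S t) e"
    using assms(1,3) by (auto simp: plan_def prec_schedule_def split: option.splits)
  ultimately show ?thesis by simp
qed

section \<open>Charging the optimum to the algorithm\<close>

lemma phi_ge_1: "1 \<le> \<phi>"
proof -
  have "1 \<le> sqrt 5" by simp
  then show ?thesis by (simp add: phi_def)
qed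

lemma phi_square: "\<phi> * \<phi> = \<phi> + 1"
  by (simp add: phi_def field_simps)

text \<open>Pays for losing both \<open>e\<close> and \<open>h\<close> when \<open>h\<close> is
  transmitted; the factor is chosen so that \<open>\<phi> * \<phi> = \<phi> + 1\<close> closes the
  estimate.\<close>

lemma phi_add_le:
  assumes "\<phi> * a \<le> b"
  shows "a + b \<le> \<phi> * b"
proof -
  have "\<phi> * (a + b) \<le> b + \<phi> * b" using assms by (simp add: algebra_simps)
  also have "\<dots> = \<phi> * (\<phi> * b)" by (simp flip: mult.assoc add: phi_square algebra_simps)
  finally show ?thesis using phi_ge_1 by simp
qed

definition value_of :: "packet option \<Rightarrow> real" where
  "value_of a = (case a of None \<Rightarrow> 0 | Some j \<Rightarrow> weight j)"

text \<open>\<open>X\<close> stands for the packets not transmitted before step \<open>t\<close>, so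
  \<open>B\<close> is the buffer. As \<open>Y'\<close> avoids the transmitted packet, the step can
  be iterated.\<close>

lemma mg_step:
  assumes I: "input_sequence I" "agreeable I" "X \<subseteq> I"
    and B: "B = {j \<in> X. release j \<le> real t \<and> t < deadline j}"
    and S: "optimal_plan t B S" "mg_transmit t S a"
    and Y: "Y \<subseteq> X" "schedulable t Y"
  obtains Y' where "Y' \<subseteq> X" "\<And>j. a = Some j \<Longrightarrow> j \<notin> Y'" "schedulable (Suc t) Y'"
    "sum weight Y \<le> \<phi> * value_of a + sum weight Y'"
proof -
  note goal = that
  define F where "F = {j \<in> X. real t < release j}"
  have finX: "finite X" using I by (auto simp: input_sequence_def intro: finite_subset)
  have pl: "plan t B S" using S by (simp add: optimal_plan_def)
  have OB: "ran S \<subseteq> B" using pl by (simp add: plan_def feasible_ran)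
  have BX: "B \<subseteq> X" using B by auto
  have pos: "0 < weight j" if "j \<in> X" for j using that I by (auto simp: input_sequence_def)
  have finO: "finite (ran S)" using finite_subset[OF subset_trans[OF OB BX] finX] .
  have schO: "schedulable t (ran S)"
    using pl by (auto simp: plan_def intro: feasible_schedulable)
  have relB: "release j \<le> real t" "t < deadline j" if "j \<in> B" for j using that B by auto
  have YBF: "Y \<subseteq> B \<union> F"
  proof
    fix j assume j: "j \<in> Y"
    then have "t < deadline j"
      using Y(2) by (fastforce simp: schedulable_def placement_def fits_def)
    then show "j \<in> B \<union> F" using j Y(1) by (auto simp: B F_def)
  qed
  have finY: "finite Y" using Y(1) finX by (rule finite_subset)
  have posB: "0 < weight j" if "j \<in> B" for j using pos that BX by auto
  have opt: "sum weight Z' \<le> sum weight (ran S)"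
    if "Z' \<subseteq> B" "schedulable t Z'" "finite Z'" for Z'
    using optimal_plan_max[OF S(1) relB(1)] that by blast
  obtain Y1 where Y1: "Y1 \<subseteq> ran S \<union> F" "finite Y1" "schedulable t Y1"
    and le: "sum weight Y \<le> sum weight Y1"
    using schedulable_reduce_to_optimal[OF finY Y(2) YBF finO OB schO posB opt] by blast
  have Y1X: "Y1 \<subseteq> X" using Y1 OB BX F_def by auto
  have now: "j \<in> ran S" if "j \<in> Y1" "release j \<le> real t" for j
    using that Y1(1) by (auto simp: F_def)
  have result: thesis if Y2: "Y2 \<subseteq> Y1" "\<And>j. a = Some j \<Longrightarrow> j \<notin> Y2" "schedulable (Suc t) Y2"
    "sum weight Y1 \<le> \<phi> * value_of a + sum weight Y2" for Y2
    by (rule goal[OF subset_trans[OF Y2(1) Y1X] Y2(2,3) order_trans[OF le Y2(4)]])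
  \<comment> \<open>Serves the cases where the transmitted packet is outside \<open>Y1\<close>: only
    the packet in slot \<open>t\<close> is lost, and being released it belongs to the plan. The
    bound \<open>w\<close> will be \<open>weight h\<close>.\<close>
  have drop: "\<exists>Y2 \<subseteq> Y1. schedulable (Suc t) Y2 \<and> sum weight Y1 \<le> w + sum weight Y2"
    if w: "\<And>j. j \<in> ran S \<Longrightarrow> weight j \<le> w" "0 \<le> w" for w
  proof (rule schedulable_Suc_remove_one[OF Y1(3)])
    assume "schedulable (Suc t) Y1"
    then show ?thesis using w(2) by auto
  next
    fix j assume j: "j \<in> Y1" "release j \<le> real t" "schedulable (Suc t) (Y1 - {j})"
    then have "sum weight Y1 \<le> w + sum weight (Y1 - {j})"
      using w(1)[OF now[OF j(1,2)]] Y1(2) by (simp add: sum_diff1)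
    then show ?thesis using j(3) by blast
  qed
  have headD: "e \<in> ran S" "j \<in> ran S \<Longrightarrow> deadline e \<le> deadline j" "e \<in> X" if "S t = Some e" for e j
    using plan_head_prec_min[OF pl _ that] relB OB BX prec_deadline by (auto simp: prec_min_def)
  have heavyD: "j \<in> ran S \<Longrightarrow> weight j \<le> weight h" "h \<in> ran S" "h \<in> X" "0 \<le> weight h"
    if "prec_min (heaviest S) h" for h j
    using that OB BX pos[of h] by (auto simp: prec_min_def heaviest_def)
  show thesis
    using S(2)
  proof cases
    case idle
    \<comment> \<open>An empty plan leaves only future packets in \<open>Y1\<close>, so none can
      occupy slot \<open>t\<close>.\<close>
    then have "ran S = {}" by simp
    then have "schedulable (Suc t) Y1"
      using now by (rule_tac schedulable_Suc_remove_one[OF Y1(3)]) auto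
    then show thesis using idle by (intro result) (auto simp: value_of_def)
  next
    case (transmit_e e h)
    note head = headD[OF transmit_e(2)] and hv = heavyD[OF transmit_e(3)]
    have val: "value_of a = weight e" using transmit_e by (simp add: value_of_def)
    show thesis
    proof (cases "e \<in> Y1")
      case True
      have "schedulable (Suc t) (Y1 - {e})"
        using head(2) now by (intro schedulable_Suc_remove_earliest Y1 True) auto
      moreover have "weight e \<le> \<phi> * weight e"
        using phi_ge_1 pos[OF head(3)] by simp
      ultimately show thesis
        using transmit_e val True Y1(2) by (intro result[of "Y1 - {e}"]) (auto simp: sum_diff1)
    next
      case False
      obtain Y2 where "Y2 \<subseteq> Y1" "schedulable (Suc t) Y2" "sum weight Y1 \<le> weight h + sum weight Y2"
        using drop hv by blast
      then show thesis using False transmit_e val by (intro result[of Y2]) auto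
    qed
  next
    case (transmit_h e h)
    note head = headD[OF transmit_h(2)] and hv = heavyD[OF transmit_h(3)]
    have val: "value_of a = weight h" using transmit_h by (simp add: value_of_def)
    have h1: "weight h \<le> \<phi> * weight h"
      using phi_ge_1 pos[OF hv(3)] by simp
    have e1: "weight e \<le> \<phi> * weight e"
      using phi_ge_1 pos[OF head(3)] by simp
    have eh: "weight e + weight h \<le> \<phi> * weight h"
      using transmit_h by (intro phi_add_le) simp
    consider "h \<notin> Y1" | "h \<in> Y1" "e \<in> Y1" | "h \<in> Y1" "e \<notin> Y1" by blast
    then show thesis
    proof cases
      case 1
      obtain Y2 where "Y2 \<subseteq> Y1" "schedulable (Suc t) Y2" "sum weight Y1 \<le> weight h + sum weight Y2"
        using drop hv by blast
      then show thesis using 1 transmit_h val h1 by (intro result[of Y2]) auto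
    next
      case 2
      have "schedulable (Suc t) (Y1 - {e})"
        using head(2) now by (intro schedulable_Suc_remove_earliest Y1 2) auto
      then have "schedulable (Suc t) (Y1 - {e} - {h})" by (rule schedulable_subset) auto
      \<comment> \<open>Distinctness ensures that both weights are subtracted; \<open>e = h\<close>
        would contradict \<open>\<phi> * weight e < weight h\<close>.\<close>
      moreover have "e \<noteq> h" using transmit_h e1 by auto
      ultimately show thesis
        using transmit_h val 2 Y1(2) eh
        by (intro result[of "Y1 - {e} - {h}"]) (auto simp: sum_diff1)
    next
      case 3
      define P where "P = {j \<in> Y1. deadline j < deadline h}"
      \<comment> \<open>A future packet is released in a later step than \<open>h\<close>, hence by
        agreeability is due no earlier; ceilings appear because \<open>agreeable\<close> compares
        release steps.\<close>
      have "P \<subseteq> ran S"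
      proof
        fix j assume j: "j \<in> P"
        have "j \<notin> F"
        proof
          assume jF: "j \<in> F"
          then have "\<lceil>release h\<rceil> \<le> int t" "int t < \<lceil>release j\<rceil>"
            using relB(1)[of h] hv(2) OB by (auto simp: F_def ceiling_le_iff less_ceiling_iff)
          then have "\<lceil>release h\<rceil> < \<lceil>release j\<rceil>" by linarith
          then have "deadline h \<le> deadline j"
            using I jF hv(3) by (auto simp: agreeable_def F_def)
          then show False using j by (simp add: P_def)
        qed
        then show "j \<in> ran S" using j Y1(1) by (auto simp: P_def)
      qed
      \<comment> \<open>The plan accommodates \<open>e\<close> together with \<open>P\<close>. Since
        \<open>e\<close> is due first, giving it up lets all of \<open>P\<close> start one step
        later.\<close>
      then have "schedulable t (insert e P)"
        using head(1) by (intro schedulable_subset[OF schO]) auto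
      then have "schedulable (Suc t) (insert e P - {e})"
        using head \<open>P \<subseteq> ran S\<close> by (intro schedulable_Suc_remove_earliest) auto
      then have "schedulable (Suc t) P" using 3 by (simp add: P_def)
      then have "schedulable (Suc t) (Y1 - {h})"
        using relB(1) \<open>P \<subseteq> ran S\<close> OB
        by (intro schedulable_Suc_remove_above[OF Y1(2,3) 3(1) P_def]) auto
      then show thesis
        using 3 transmit_h val h1 Y1(2) by (intro result[of "Y1 - {h}"]) (auto simp: sum_diff1)
    qed
  qed
qed

text \<open>Telescopes \<open>mg_step\<close> by downward induction from the horizon
  \<open>N\<close>, where every deadline has passed and \<open>Y\<close> must be empty.\<close>

lemma mg_run_bound:
  assumes I: "input_sequence I" "agreeable I" "mg_run I A"
    and N: "\<And>j. j \<in> I \<Longrightarrow> deadline j \<le> N"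
    and "t \<le> N" "Y \<subseteq> {j \<in> I. \<forall>s<t. A s \<noteq> Some j}" "schedulable t Y"
  shows "sum weight Y \<le> \<phi> * (\<Sum>s = t..<N. value_of (A s))"
  using assms(5-7)
proof (induction t arbitrary: Y rule: inc_induct)
  case base
  have "Y = {}"
  proof (rule ccontr)
    assume "Y \<noteq> {}"
    then obtain j where "j \<in> Y" by blast
    then show False
      using base N[of j] by (fastforce simp: schedulable_def placement_def fits_def)
  qed
  then show ?case by simp
next
  case (step t)
  let ?X = "{j \<in> I. \<forall>s<t. A s \<noteq> Some j}"
  obtain S where S: "optimal_plan t (pending I A t) S" "mg_transmit t S (A t)"
    using I(3) by (auto simp: mg_run_def)
  have "pending I A t = {j \<in> ?X. release j \<le> real t \<and> t < deadline j}"
    by (auto simp: pending_def)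
  then obtain Y' where Y': "Y' \<subseteq> ?X" "\<And>j. A t = Some j \<Longrightarrow> j \<notin> Y'" "schedulable (Suc t) Y'"
    "sum weight Y \<le> \<phi> * value_of (A t) + sum weight Y'"
    using mg_step[OF I(1,2) _ _ S step.prems] by blast
  have "Y' \<subseteq> {j \<in> I. \<forall>s<Suc t. A s \<noteq> Some j}"
    using Y'(1,2) by (auto simp: less_Suc_eq)
  then have "sum weight Y' \<le> \<phi> * (\<Sum>s = Suc t..<N. value_of (A s))"
    using step.IH Y'(3) by blast
  then show ?case
    using Y'(4) step.hyps by (simp add: sum.atLeast_Suc_lessThan distrib_left)
qed

text \<open>Each transmitted packet belongs to the plan, hence to the buffer, and the buffer
  excludes earlier transmissions; this yields injectivity.\<close>

lemma mg_run_feasible: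
  assumes "mg_run I A"
  shows "feasible I A"
proof -
  have pend: "j \<in> pending I A t" if j: "A t = Some j" for t j
  proof -
    obtain S where S: "optimal_plan t (pending I A t) S" "mg_transmit t S (A t)"
      using assms by (auto simp: mg_run_def)
    have "ran S \<subseteq> pending I A t"
      using S(1) by (simp add: optimal_plan_def plan_def feasible_ran)
    moreover have "j \<in> ran S"
      using S(2) j by cases (auto simp: prec_min_def heaviest_def intro: ranI)
    ultimately show ?thesis by blast
  qed
  moreover have "inj_on A (dom A)"
  proof (rule inj_onI)
    fix s t assume st: "s \<in> dom A" "t \<in> dom A" "A s = A t"
    then obtain j where j: "A s = Some j" "A t = Some j" by auto
    show "s = t"
      using pend[OF j(1)] pend[OF j(2)] j
      by (cases s t rule: linorder_cases) (auto simp: pending_def)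
  qed
  ultimately show ?thesis by (simp add: feasible_def)
qed

text \<open>Passes from a sum over steps to one over packets: injectivity prevents double counting,
  and packets sent outside \<open>T\<close> contribute nonnegatively.\<close>

lemma sum_value_of_le_gain:
  assumes "feasible X A" "finite X" "\<And>j. j \<in> X \<Longrightarrow> 0 \<le> weight j" "finite T"
  shows "(\<Sum>s\<in>T. value_of (A s)) \<le> gain A"
proof -
  have inj: "inj_on (\<lambda>s. the (A s)) (T \<inter> dom A)"
    using assms(1) by (auto simp: feasible_def inj_on_def dom_def)
  have "(\<Sum>s\<in>T. value_of (A s)) = (\<Sum>s\<in>T \<inter> dom A. weight (the (A s)))"
    using assms(4) by (intro sum.mono_neutral_cong_right) (auto simp: value_of_def split: option.splits)
  also have "\<dots> = sum weight ((\<lambda>s. the (A s)) ` (T \<inter> dom A))"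
    using inj by (simp add: sum.reindex)
  also have "\<dots> \<le> gain A"
    unfolding gain_def
    using feasible_ran[OF assms(1)] assms(2,3) by (intro sum_mono2) (auto simp: ran_def intro: finite_subset)
  finally show ?thesis .
qed

theorem theorem3p1:
  fixes I :: "packet set" and A :: schedule
  assumes "input_sequence I" and "agreeable I" and "mg_run I A"
  shows "gain A \<ge> 1 / \<phi> * opt I"
proof -
  have fin: "finite I" using assms(1) by (simp add: input_sequence_def)
  have pos: "0 \<le> weight j" if "j \<in> I" for j
    using assms(1) that by (auto simp: input_sequence_def)
  define N where "N = Max (insert 0 (deadline ` I))"
  have N: "deadline j \<le> N" if "j \<in> I" for j using fin that by (simp add: N_def)
  have bound: "gain S \<le> \<phi> * gain A" if S: "feasible I S" for S
  proof -
    \<comment> \<open>At step \<open>0\<close> nothing has been transmitted yet, so the packets of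
      any feasible schedule qualify as \<open>Y\<close>.\<close>
    have "gain S \<le> \<phi> * (\<Sum>s = 0..<N. value_of (A s))"
      unfolding gain_def
      using N feasible_ran[OF S] feasible_schedulable[OF S]
      by (intro mg_run_bound[OF assms]) auto
    also have "\<dots> \<le> \<phi> * gain A"
      using sum_value_of_le_gain[OF mg_run_feasible[OF assms(3)] fin pos] phi_ge_1
      by (intro mult_left_mono) auto
    finally show ?thesis .
  qed
  have "{gain S | S. feasible I S} \<subseteq> sum weight ` Pow I"
    using feasible_ran by (auto simp: gain_def)
  then have "finite {gain S | S. feasible I S}"
    using fin finite_subset by blast
  moreover have "feasible I Map.empty" by (simp add: feasible_def)
  ultimately have "opt I \<le> \<phi> * gain A"
    unfolding opt_def using bound by (intro Max.boundedI) auto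
  then show ?thesis using phi_ge_1 by (simp add: field_simps)
qed

end
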